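(* Consider the following translation of $\lambda\mathbf{J}$ into simply-typed $\lambda$-calculus. Types: $\overline{A}=\top\supset\neg\neg A^*$, $X^*=X$, $(A\supset B)^*=\overline{A}\supset\overline{B}$. Terms: $\overline{t}=\lambda gk.(t:g,k)$, $(x:G,K)=xGK$, $(\lambda x.t:G,K)=[K(\lambda x.\overline{t});G]$, $(t(u,x.v):G,K)=(t:G^+,\lambda m.(\lambda x.(v:G,K))(m\,\overline{u}))$. Then: (1) if $\Gamma\vdash t:A$ in $\lambda\mathbf{J}$ then $\overline{\Gamma}\vdash\overline{t}:\overline{A}$ in the simply-typed $\lambda$-calculus; (2) if $t\rightarrow u$ in $\lambda\mathbf{J}$, then $\overline{t}\rightarrow^+_\beta\overline{u}$.
   Context: $\lambda\mathbf{J}$: types $A::=X\mid A\supset B$; terms $t,u,v::=x\mid\lambda x.t\mid t(u,x.v)$ ($x$ bound in $v$). Typing: $\Gamma,x:A\vdash x:A$; from $\Gamma,x:A\vdash t:B$ infer $\Gamma\vdash\lambda x.t:A\supset B$; from $\Gamma\vdash t:A\supset B$, $\Gamma\vdash u:A$, $\Gamma,x:B\vdash v:C$ infer $\Gamma\vdash t(u,x.v):C$. A value $V$ is a variable or a $\lambda$-abstraction; generalised arguments $R,S$ are pairs $(u,x.v)$, $tRS=(tR)S$; $(u,x.V)@S=(u,x.VS)$, $(u,x.tR')@S=(u,x.t(R'@S))$. Reduction: closure under all constructors of $(\lambda x.t)(u,y.v)\rightarrow[[u/x]t/y]v$ and $tRS\rightarrow t(R@S)$. In the target: $\bot$ is a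 fixed type variable, $\neg A=A\supset\bot$, $\top$ is a fixed type and $\mathsf{s}:\top\supset\top$ a fixed closed term with $\mathsf{s}\,G\rightarrow^+_\beta G$ for all $G$ (e.g. $\mathsf{s}=\lambda z.z$), $G^+:=\mathsf{s}\,G$; $[t;u]:=(\lambda y.t)u$ with $y$ not free in $t$; $g,k,m$ fresh variables; $\overline{\Gamma}$ replaces each declaration $x:C$ of $\Gamma$ by $x:\overline{C}$. *)

theory Defs
  imports Main
begin

text \<open>
  Terms of both calculi are considered up to renaming of bound variables and are therefore
  represented with de Bruijn indices. A typing context is a list of types; index \<open>i\<close> is declared
  with type \<open>\<Gamma> ! i\<close>, and \<open>\<Gamma>, x : A\<close> becomes \<open>A # \<Gamma>\<close>. The freshness conditions of the named
  presentation become liftings (\<open>jlift c\<close>, \<open>lift c\<close> add one to all free indices \<open>\<ge> c\<close>).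
  Both calculi are in Curry style and share the same simple types.
\<close>

datatype ty = TVar nat | Fun ty ty (infixr "\<supset>" 65)


section \<open>The calculus \<open>\<lambda>J\<close>\<close>

text \<open>In \<open>JApp t u v\<close>, which stands for \<open>t(u, x.v)\<close>, index 0 is bound in \<open>v\<close> only.\<close>

datatype jtrm = JVar nat | JLam jtrm | JApp jtrm jtrm jtrm

text \<open>A generalised argument \<open>(u, x.v)\<close> is the pair of \<open>u\<close> and the body \<open>v\<close>, in which index 0 is
  bound.\<close>

type_synonym garg = "jtrm \<times> jtrm"

definition japp :: "jtrm \<Rightarrow> garg \<Rightarrow> jtrm" (infixl "\<cdot>" 200) where
  "t \<cdot> R = JApp t (fst R) (snd R)"

primrec jlift :: "nat \<Rightarrow> jtrm \<Rightarrow> jtrm" where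
  "jlift c (JVar i) = JVar (if i < c then i else Suc i)"
| "jlift c (JLam t) = JLam (jlift (Suc c) t)"
| "jlift c (JApp t u v) = JApp (jlift c t) (jlift c u) (jlift (Suc c) v)"

definition glift :: "nat \<Rightarrow> garg \<Rightarrow> garg" where
  "glift c R = (jlift c (fst R), jlift (Suc c) (snd R))"

text \<open>\<open>jsubst u k t\<close> substitutes \<open>u\<close> for index \<open>k\<close> in \<open>t\<close> and removes that index, i.e. the indices
  above \<open>k\<close> are decremented.\<close>

primrec jsubst :: "jtrm \<Rightarrow> nat \<Rightarrow> jtrm \<Rightarrow> jtrm" where
  "jsubst u k (JVar i) = (if i < k then JVar i else if i = k then u else JVar (i - 1))"
| "jsubst u k (JLam t) = JLam (jsubst (jlift 0 u) (Suc k) t)"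
| "jsubst u k (JApp t w v) =
     JApp (jsubst u k t) (jsubst u k w) (jsubst (jlift 0 u) (Suc k) v)"

inductive jtyping :: "ty list \<Rightarrow> jtrm \<Rightarrow> ty \<Rightarrow> bool" ("_ \<turnstile>\<^sub>J _ : _" [50, 50, 50] 50) where
  jt_var: "i < length \<Gamma> \<Longrightarrow> \<Gamma> ! i = A \<Longrightarrow> \<Gamma> \<turnstile>\<^sub>J JVar i : A"
| jt_lam: "A # \<Gamma> \<turnstile>\<^sub>J t : B \<Longrightarrow> \<Gamma> \<turnstile>\<^sub>J JLam t : A \<supset> B"
| jt_app: "\<Gamma> \<turnstile>\<^sub>J t : A \<supset> B \<Longrightarrow> \<Gamma> \<turnstile>\<^sub>J u : A \<Longrightarrow> B # \<Gamma> \<turnstile>\<^sub>J v : C \<Longrightarrow> \<Gamma> \<turnstile>\<^sub>J JApp t u v : C"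

text \<open>\<open>R @ S\<close>: the first two equations are the case \<open>(u, x.V) @ S\<close> for the two kinds of values
  \<open>V\<close>. In all equations \<open>S\<close> moves under the binder \<open>x\<close>.\<close>

fun gappend :: "garg \<Rightarrow> garg \<Rightarrow> garg" where
  "gappend (u, JVar i) S = (u, JVar i \<cdot> glift 0 S)"
| "gappend (u, JLam t) S = (u, JLam t \<cdot> glift 0 S)"
| "gappend (u, JApp t u' v') S = (u, t \<cdot> gappend (u', v') (glift 0 S))"

inductive jred :: "jtrm \<Rightarrow> jtrm \<Rightarrow> bool" (infix "\<rightarrow>\<^sub>J" 50) where
  jr_beta: "JApp (JLam t) u v \<rightarrow>\<^sub>J jsubst (jsubst u 0 t) 0 v"
| jr_pi: "t \<cdot> R \<cdot> S \<rightarrow>\<^sub>J t \<cdot> gappend R S"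
| jr_lam: "t \<rightarrow>\<^sub>J t' \<Longrightarrow> JLam t \<rightarrow>\<^sub>J JLam t'"
| jr_app1: "t \<rightarrow>\<^sub>J t' \<Longrightarrow> JApp t u v \<rightarrow>\<^sub>J JApp t' u v"
| jr_app2: "u \<rightarrow>\<^sub>J u' \<Longrightarrow> JApp t u v \<rightarrow>\<^sub>J JApp t u' v"
| jr_app3: "v \<rightarrow>\<^sub>J v' \<Longrightarrow> JApp t u v \<rightarrow>\<^sub>J JApp t u v'"


section \<open>The simply-typed \<open>\<lambda>\<close>-calculus\<close>

datatype trm = Var nat | Lam trm | App trm trm

primrec lift :: "nat \<Rightarrow> trm \<Rightarrow> trm" where
  "lift c (Var i) = Var (if i < c then i else Suc i)"
| "lift c (Lam t) = Lam (lift (Suc c) t)"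
| "lift c (App t u) = App (lift c t) (lift c u)"

primrec subst :: "trm \<Rightarrow> nat \<Rightarrow> trm \<Rightarrow> trm" where
  "subst u k (Var i) = (if i < k then Var i else if i = k then u else Var (i - 1))"
| "subst u k (Lam t) = Lam (subst (lift 0 u) (Suc k) t)"
| "subst u k (App t w) = App (subst u k t) (subst u k w)"

primrec fv :: "trm \<Rightarrow> nat set" where
  "fv (Var i) = {i}"
| "fv (Lam t) = {i. Suc i \<in> fv t}"
| "fv (App t u) = fv t \<union> fv u"

definition closed_trm :: "trm \<Rightarrow> bool" where
  "closed_trm t \<longleftrightarrow> fv t = {}"

inductive typing :: "ty list \<Rightarrow> trm \<Rightarrow> ty \<Rightarrow> bool" ("_ \<turnstile> _ : _" [50, 50, 50] 50) where
  t_var: "i < length \<Gamma> \<Longrightarrow> \<Gamma> ! i = A \<Longrightarrow> \<Gamma> \<turnstile> Var i : A"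
| t_lam: "A # \<Gamma> \<turnstile> t : B \<Longrightarrow> \<Gamma> \<turnstile> Lam t : A \<supset> B"
| t_app: "\<Gamma> \<turnstile> t : A \<supset> B \<Longrightarrow> \<Gamma> \<turnstile> u : A \<Longrightarrow> \<Gamma> \<turnstile> App t u : B"

inductive beta :: "trm \<Rightarrow> trm \<Rightarrow> bool" (infix "\<rightarrow>\<^sub>\<beta>" 50) where
  b_beta: "App (Lam t) u \<rightarrow>\<^sub>\<beta> subst u 0 t"
| b_lam: "t \<rightarrow>\<^sub>\<beta> t' \<Longrightarrow> Lam t \<rightarrow>\<^sub>\<beta> Lam t'"
| b_app1: "t \<rightarrow>\<^sub>\<beta> t' \<Longrightarrow> App t u \<rightarrow>\<^sub>\<beta> App t' u"
| b_app2: "u \<rightarrow>\<^sub>\<beta> u' \<Longrightarrow> App t u \<rightarrow>\<^sub>\<beta> App t u'"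

abbreviation beta_plus :: "trm \<Rightarrow> trm \<Rightarrow> bool" (infix "\<rightarrow>\<^sub>\<beta>\<^sup>+" 50) where
  "t \<rightarrow>\<^sub>\<beta>\<^sup>+ u \<equiv> beta\<^sup>+\<^sup>+ t u"


section \<open>The translation\<close>

text \<open>The fixed type variable \<open>\<bottom>\<close>, the fixed type \<open>\<top>\<close> and the fixed term \<open>s\<close> are the parameters
  \<open>b\<close>, \<open>T\<close> and \<open>s\<close>.\<close>

definition neg :: "nat \<Rightarrow> ty \<Rightarrow> ty" where
  "neg b A = A \<supset> TVar b"

function ty_star :: "nat \<Rightarrow> ty \<Rightarrow> ty \<Rightarrow> ty" and ty_bar :: "nat \<Rightarrow> ty \<Rightarrow> ty \<Rightarrow> ty" where
  "ty_star b T (TVar X) = TVar X"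
| "ty_star b T (A \<supset> B) = ty_bar b T A \<supset> ty_bar b T B"
| "ty_bar b T A = T \<supset> neg b (neg b (ty_star b T A))"
  by pat_completeness auto
termination
  by (relation "measure (case_sum (\<lambda>(b, T, A). 2 * size A) (\<lambda>(b, T, A). 2 * size A + 1))") auto

text \<open>\<open>[t; u]\<close>\<close>

definition semi :: "trm \<Rightarrow> trm \<Rightarrow> trm" where
  "semi t u = App (Lam (lift 0 t)) u"

lemma size_jlift [simp]: "size (jlift c t) = size t"
  by (induction t arbitrary: c) auto

text \<open>
  \<open>colon s t G K\<close> is \<open>(t : G, K)\<close> and \<open>cps s t\<close> is the translation of the term \<open>t\<close>; moreover
  \<open>App s G\<close> is \<open>G\<^sup>+\<close>. As \<open>s\<close> is closed, it is not lifted.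
  In \<open>cps\<close>, index 1 is \<open>g\<close> and index 0 is \<open>k\<close>. In the last equation for \<open>colon\<close>, \<open>v\<close> ends up below
  the binders of \<open>m\<close> (outer) and \<open>x\<close> (inner); index 0 of \<open>v\<close> is already \<open>x\<close>, so room for \<open>m\<close> is
  made by \<open>jlift 1\<close>.
\<close>

function colon :: "trm \<Rightarrow> jtrm \<Rightarrow> trm \<Rightarrow> trm \<Rightarrow> trm" and cps :: "trm \<Rightarrow> jtrm \<Rightarrow> trm" where
  "colon s (JVar x) G K = App (App (Var x) G) K"
| "colon s (JLam t) G K = semi (App K (Lam (cps s t))) G"
| "colon s (JApp t u v) G K =
     colon s t (App s G)
       (Lam (App (Lam (colon s (jlift 1 v) (lift 0 (lift 0 G)) (lift 0 (lift 0 K))))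
                 (App (Var 0) (cps s (jlift 0 u)))))"
| "cps s t = Lam (Lam (colon s (jlift 0 (jlift 0 t)) (Var 1) (Var 0)))"
  by pat_completeness auto
termination
  by (relation "measure (case_sum (\<lambda>(s, t, G, K). 2 * size t) (\<lambda>(s, t). 2 * size t + 1))") auto

end

theory Submission
  imports Defs
begin

text \<open>
  The translation of a \<open>\<pi>\<close>-redex and that of its contractum differ only in an extra \<open>s\<close> around the
  argument \<open>G\<close>, and \<open>G\<close> is never erased before it is reached: \<open>(t : G, K)\<close> strictly reduces
  whenever \<open>G\<close> or \<open>K\<close> does. A \<open>\<beta>\<close>-redex is simulated directly, because substituting \<open>cps s u\<close> for a
  variable \<open>x\<close> in \<open>(t : G, K)\<close> turns each head \<open>x G K\<close> into a redex that contracts to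
  \<open>(u : G, K)\<close>.
\<close>

declare cps.simps [simp del] ty_bar.simps [simp del]


section \<open>Lifting and substitution\<close>

lemma lift_lift: "c \<le> d \<Longrightarrow> lift (Suc d) (lift c t) = lift c (lift d t)"
  by (induction t arbitrary: c d) auto

lemma jlift_jlift: "c \<le> d \<Longrightarrow> jlift (Suc d) (jlift c t) = jlift c (jlift d t)"
  by (induction t arbitrary: c d) auto

lemma subst_lift [simp]: "subst u k (lift k t) = t"
  by (induction t arbitrary: u k) auto

lemma subst_lift_le: "c \<le> k \<Longrightarrow> subst (lift c u) (Suc k) (lift c t) = lift c (subst u k t)"
  by (induction t arbitrary: c k u) (auto simp: lift_lift[symmetric])

lemma jsubst_jlift_le: "c \<le> k \<Longrightarrow> jsubst (jlift c u) (Suc k) (jlift c t) = jlift c (jsubst u k t)"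
  by (induction t arbitrary: c k u) (auto simp: jlift_jlift[symmetric])

lemma lift_subst: "k \<le> c \<Longrightarrow> lift c (subst u k t) = subst (lift c u) k (lift (Suc c) t)"
  by (induction t arbitrary: c k u) (auto simp: lift_lift[symmetric])

lemma jlift_jsubst: "k \<le> c \<Longrightarrow> jlift c (jsubst u k t) = jsubst (jlift c u) k (jlift (Suc c) t)"
  by (induction t arbitrary: c k u) (auto simp: jlift_jlift[symmetric])

section \<open>Closed terms under lifting and substitution\<close>

lemma lift_ident: "\<forall>i\<in>fv t. i < c \<Longrightarrow> lift c t = t"
proof (induction t arbitrary: c)
  case (Lam t)
  have "\<forall>i\<in>fv t. i < Suc c"
    using Lam.prems by (auto simp: less_Suc_eq_0_disj) (metis not0_implies_Suc)
  then show ?case by (simp add: Lam.IH)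
qed auto

lemma subst_ident: "\<forall>i\<in>fv t. i < k \<Longrightarrow> subst u k t = t"
proof (induction t arbitrary: u k)
  case (Lam t)
  have "\<forall>i\<in>fv t. i < Suc k"
    using Lam.prems by (auto simp: less_Suc_eq_0_disj) (metis not0_implies_Suc)
  then show ?case by (simp add: Lam.IH)
qed auto

lemma closed_lift: "closed_trm t \<Longrightarrow> lift c t = t"
  by (simp add: closed_trm_def lift_ident)

lemma closed_subst: "closed_trm t \<Longrightarrow> subst u k t = t"
  by (simp add: closed_trm_def subst_ident)

section \<open>Lifting of generalised arguments and of source reduction\<close>

lemma jlift_japp: "jlift c (t \<cdot> R) = jlift c t \<cdot> glift c R"
  by (simp add: japp_def glift_def)

lemma glift_glift: "c \<le> d \<Longrightarrow> glift (Suc d) (glift c R) = glift c (glift d R)"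
  by (simp add: glift_def jlift_jlift)

lemma jlift_gappend: "glift c (gappend R S) = gappend (glift c R) (glift c S)"
proof (induction R S arbitrary: c rule: gappend.induct)
  case (3 u t u' v' S)
  have "glift c (gappend (u, JApp t u' v') S) =
      (jlift c u, jlift (Suc c) t \<cdot> gappend (glift (Suc c) (u', v')) (glift (Suc c) (glift 0 S)))"
    by (simp add: 3[symmetric] jlift_japp glift_def[of c])
  then show ?case
    by (simp add: glift_glift) (simp add: glift_def)
qed (simp_all add: glift_def japp_def jlift_jlift[symmetric])

text \<open>\<open>colon\<close> translates the parts \<open>u\<close> and \<open>v\<close> of an
  application in shifted form, so a reduction inside them has to be shifted as well.\<close>

lemma jred_jlift: "t \<rightarrow>\<^sub>J t' \<Longrightarrow> jlift c t \<rightarrow>\<^sub>J jlift c t'"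
proof (induction arbitrary: c rule: jred.induct)
  case (jr_beta t u v)
  then show ?case
    by (simp add: jlift_jsubst jred.jr_beta)
next
  case (jr_pi t R S)
  show ?case
    unfolding jlift_japp jlift_gappend by (rule jred.jr_pi)
qed (auto intro: jred.intros)


section \<open>Congruence properties of \<open>\<beta>\<close>-reduction\<close>

lemma tranclp_map:
  assumes "\<And>x y. r x y \<Longrightarrow> r'\<^sup>+\<^sup>+ (f x) (f y)" and "r\<^sup>+\<^sup>+ x y"
  shows "r'\<^sup>+\<^sup>+ (f x) (f y)"
  using assms(2) by induction (auto intro: assms(1) tranclp_trans)

lemma beta_star_cong:
  assumes "\<And>x y. x \<rightarrow>\<^sub>\<beta>\<^sup>+ y \<Longrightarrow> f x \<rightarrow>\<^sub>\<beta>\<^sup>+ f y" and "beta\<^sup>*\<^sup>* x y"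
  shows "beta\<^sup>*\<^sup>* (f x) (f y)"
  using assms by (metis rtranclpD rtranclp.rtrancl_refl tranclp_into_rtranclp)

lemma beta_lift: "t \<rightarrow>\<^sub>\<beta> t' \<Longrightarrow> lift c t \<rightarrow>\<^sub>\<beta> lift c t'"
  by (induction arbitrary: c rule: beta.induct) (auto simp: lift_subst intro: beta.intros)

lemma beta_plus_lift: "t \<rightarrow>\<^sub>\<beta>\<^sup>+ t' \<Longrightarrow> lift c t \<rightarrow>\<^sub>\<beta>\<^sup>+ lift c t'"
  by (rule tranclp_map[where f = "lift c"]) (auto intro: beta_lift)

lemma beta_plus_Lam: "t \<rightarrow>\<^sub>\<beta>\<^sup>+ t' \<Longrightarrow> Lam t \<rightarrow>\<^sub>\<beta>\<^sup>+ Lam t'"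
  by (rule tranclp_map[where f = Lam]) (auto intro: b_lam)

lemma beta_plus_App1: "t \<rightarrow>\<^sub>\<beta>\<^sup>+ t' \<Longrightarrow> App t u \<rightarrow>\<^sub>\<beta>\<^sup>+ App t' u"
  by (rule tranclp_map[where f = "\<lambda>t. App t u"]) (auto intro: b_app1)

lemma beta_plus_App2: "u \<rightarrow>\<^sub>\<beta>\<^sup>+ u' \<Longrightarrow> App t u \<rightarrow>\<^sub>\<beta>\<^sup>+ App t u'"
  by (rule tranclp_map[where f = "App t"]) (auto intro: b_app2)

lemma beta_plus_semi1: "t \<rightarrow>\<^sub>\<beta>\<^sup>+ t' \<Longrightarrow> semi t u \<rightarrow>\<^sub>\<beta>\<^sup>+ semi t' u"
  unfolding semi_def by (intro beta_plus_App1 beta_plus_Lam beta_plus_lift)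

lemma beta_plus_semi2: "u \<rightarrow>\<^sub>\<beta>\<^sup>+ u' \<Longrightarrow> semi t u \<rightarrow>\<^sub>\<beta>\<^sup>+ semi t u'"
  unfolding semi_def by (rule beta_plus_App2)

lemma semi_beta: "semi t u \<rightarrow>\<^sub>\<beta> t"
  unfolding semi_def by (metis b_beta subst_lift)

lemma lift_semi: "lift c (semi t u) = semi (lift c t) (lift c u)"
  by (simp add: semi_def lift_lift)

lemma subst_semi: "subst w k (semi t u) = semi (subst w k t) (subst w k u)"
  by (simp add: semi_def subst_lift_le)

lemma beta_star_Lam: "beta\<^sup>*\<^sup>* t t' \<Longrightarrow> beta\<^sup>*\<^sup>* (Lam t) (Lam t')"
  by (rule beta_star_cong[OF beta_plus_Lam])

lemma beta_star_App1: "beta\<^sup>*\<^sup>* t t' \<Longrightarrow> beta\<^sup>*\<^sup>* (App t u) (App t' u)"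
  by (rule beta_star_cong[OF beta_plus_App1])

lemma beta_star_App2: "beta\<^sup>*\<^sup>* u u' \<Longrightarrow> beta\<^sup>*\<^sup>* (App t u) (App t u')"
  by (rule beta_star_cong[OF beta_plus_App2])

lemma beta_star_semi1: "beta\<^sup>*\<^sup>* t t' \<Longrightarrow> beta\<^sup>*\<^sup>* (semi t u) (semi t' u)"
  by (rule beta_star_cong[where f = "\<lambda>t. semi t u", OF beta_plus_semi1])



section \<open>Simulation\<close>

text \<open>Closedness matters because \<open>colon\<close> places \<open>s\<close> below binders
  without lifting it.\<close>

lemma lift_colon_cps:
  shows "closed_trm s \<Longrightarrow> lift c (colon s t G K) = colon s (jlift c t) (lift c G) (lift c K)"
    and "closed_trm s \<Longrightarrow> lift c (cps s t) = cps s (jlift c t)"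
  by (induction s t G K and s t arbitrary: c and c rule: colon_cps.induct)
    (simp_all add: cps.simps lift_semi closed_lift lift_lift jlift_jlift)

text \<open>The shift \<open>jlift 1 v\<close> in the equation for \<open>colon\<close> blocks structural induction; in \<open>kont\<close> it is
  moved to the target side.\<close>

definition kont :: "trm \<Rightarrow> jtrm \<Rightarrow> jtrm \<Rightarrow> trm \<Rightarrow> trm \<Rightarrow> trm" where
  "kont s u v G K =
    Lam (App (Lam (lift 1 (colon s v (lift 0 G) (lift 0 K)))) (App (Var 0) (lift 0 (cps s u))))"

text \<open>The shift of \<open>v\<close> and one lift each of \<open>G\<close> and \<open>K\<close>
  combine into a single outer \<open>lift 1\<close>, which makes room for \<open>m\<close> beyond
  \<open>x\<close>. Structural induction then reaches \<open>v\<close> itself.\<close>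

lemma colon_JApp:
  "closed_trm s \<Longrightarrow> colon s (JApp t u v) G K = colon s t (App s G) (kont s u v G K)"
  by (simp add: kont_def lift_colon_cps lift_lift)

lemma subst_kont:
  "subst w k (kont s u v G K) =
    Lam (App (Lam (lift 1 (subst (lift 0 w) (Suc k) (colon s v (lift 0 G) (lift 0 K)))))
      (App (Var 0) (lift 0 (subst w k (cps s u)))))"
  \<comment> \<open>Below \<open>m\<close> and \<open>x\<close> the substituted term is
    \<open>lift 0 (lift 0 w)\<close>, which equals \<open>lift 1 (lift 0 w)\<close>; this form
    commutes with the outer \<open>lift 1\<close>.\<close>
  using subst_lift_le[of 1 "Suc k" "lift 0 w" "colon s v (lift 0 G) (lift 0 K)"]
  by (simp add: kont_def subst_lift_le lift_lift)

lemma subst_cps_jlift: "closed_trm s \<Longrightarrow> subst w k (cps s (jlift k t)) = cps s t"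
  by (metis lift_colon_cps(2) subst_lift)

text \<open>Index \<open>k\<close> does not occur in \<open>jlift k t\<close>, so the substitution
  can act only on \<open>G\<close> and \<open>K\<close>.\<close>

lemma subst_colon_jlift:
  assumes "closed_trm s"
  shows "subst w k (colon s (jlift k t) G K) = colon s t (subst w k G) (subst w k K)"
  using assms
proof (induction t arbitrary: w k G K)
  case (JApp t u v)
  have "subst w k (kont s (jlift k u) (jlift (Suc k) v) G K) =
      kont s u v (subst w k G) (subst w k K)"
    unfolding subst_kont subst_cps_jlift[OF assms] JApp.IH(3)[OF assms]
    by (simp add: kont_def subst_lift_le)
  then show ?case
    by (simp add: colon_JApp[OF assms] JApp.IH(1)[OF assms] closed_subst[OF assms]
        del: colon.simps(3))
qed (simp_all add: subst_semi subst_cps_jlift)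

lemma cps_App_App_beta:
  assumes "closed_trm s"
  shows "App (App (cps s t) G) K \<rightarrow>\<^sub>\<beta>\<^sup>+ colon s t G K"
proof -
  \<comment> \<open>Below the binder of \<open>k\<close>, the variable \<open>g\<close> is index 1,
    so one shift is rewritten to \<open>jlift 1\<close>, the form matched by
    \<open>subst_colon_jlift\<close>.\<close>
  have "jlift 0 (jlift 0 t) = jlift 1 (jlift 0 t)"
    by (simp add: jlift_jlift)
  then have "subst G 0 (Lam (colon s (jlift 0 (jlift 0 t)) (Var 1) (Var 0))) =
      Lam (colon s (jlift 0 t) (lift 0 G) (Var 0))"
    by (simp add: subst_colon_jlift[OF assms, of _ "Suc 0"])
  then have "App (App (cps s t) G) K \<rightarrow>\<^sub>\<beta> App (Lam (colon s (jlift 0 t) (lift 0 G) (Var 0))) K"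
    by (metis b_app1 b_beta cps.simps)
  moreover have "App (Lam (colon s (jlift 0 t) (lift 0 G) (Var 0))) K \<rightarrow>\<^sub>\<beta> colon s t G K"
    using b_beta[of "colon s (jlift 0 t) (lift 0 G) (Var 0)" K]
    by (simp add: subst_colon_jlift[OF assms])
  ultimately show ?thesis by auto
qed

section \<open>Strict monotonicity of the colon translation in \<open>K\<close> and
  \<open>G\<close>\<close>

lemma beta_plus_kont:
  assumes "colon s v (lift 0 G) (lift 0 K) \<rightarrow>\<^sub>\<beta>\<^sup>+ colon s v' (lift 0 G') (lift 0 K')"
  shows "kont s u v G K \<rightarrow>\<^sub>\<beta>\<^sup>+ kont s u v' G' K'"
  unfolding kont_def by (intro beta_plus_Lam beta_plus_App1 beta_plus_lift assms)

text \<open>No equation of \<open>colon\<close> erases \<open>K\<close>. For an application it sits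
  in the continuation: the induction hypothesis for \<open>v\<close> reduces \<open>kont\<close>,
  and the one for \<open>t\<close> propagates this.\<close>

lemma colon_cong_K:
  assumes "closed_trm s" and "K \<rightarrow>\<^sub>\<beta>\<^sup>+ K'"
  shows "colon s t G K \<rightarrow>\<^sub>\<beta>\<^sup>+ colon s t G K'"
  using assms(2)
proof (induction t arbitrary: G K K')
  case (JApp t u v)
  have "kont s u v G K \<rightarrow>\<^sub>\<beta>\<^sup>+ kont s u v G K'"
    by (rule beta_plus_kont, rule JApp.IH, rule beta_plus_lift, rule JApp.prems)
  then show ?case
    unfolding colon_JApp[OF assms(1)] by (rule JApp.IH)
qed (auto intro: beta_plus_App1 beta_plus_App2 beta_plus_semi1)

text \<open>For an abstraction, \<open>G\<close> survives as the argument of \<open>semi\<close>.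
  For an application it occurs twice, next to \<open>s\<close> and inside \<open>kont\<close>; the
  second copy is reduced by \<open>colon_cong_K\<close>.\<close>

lemma colon_cong_G:
  assumes "closed_trm s" and "G \<rightarrow>\<^sub>\<beta>\<^sup>+ G'"
  shows "colon s t G K \<rightarrow>\<^sub>\<beta>\<^sup>+ colon s t G' K"
  using assms(2)
proof (induction t arbitrary: G G' K)
  case (JApp t u v)
  have "colon s t (App s G) (kont s u v G K) \<rightarrow>\<^sub>\<beta>\<^sup>+ colon s t (App s G') (kont s u v G K)"
    by (rule JApp.IH, rule beta_plus_App2, rule JApp.prems)
  also have "\<dots> \<rightarrow>\<^sub>\<beta>\<^sup>+ colon s t (App s G') (kont s u v G' K)"
    by (rule colon_cong_K[OF assms(1)], rule beta_plus_kont, rule JApp.IH, rule beta_plus_lift,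
        rule JApp.prems)
  finally show ?case
    unfolding colon_JApp[OF assms(1)] .
qed (auto intro: beta_plus_App1 beta_plus_App2 beta_plus_semi2)

lemma colon_star_cong_K:
  "closed_trm s \<Longrightarrow> beta\<^sup>*\<^sup>* K K' \<Longrightarrow> beta\<^sup>*\<^sup>* (colon s t G K) (colon s t G K')"
  by (rule beta_star_cong[OF colon_cong_K])

text \<open>Equality fails at the variable \<open>k\<close> itself, where \<open>cps s u\<close>
  lands in head position and \<open>cps_App_App_beta\<close> must contract it. If \<open>k\<close>
  does not occur in \<open>t\<close>, no step is made, hence the reflexive closure.\<close>

lemma subst_colon_cps:
  shows "closed_trm s \<Longrightarrow> beta\<^sup>*\<^sup>* (subst (cps s u) k (colon s t G K))
      (colon s (jsubst u k t) (subst (cps s u) k G) (subst (cps s u) k K))"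
    and "closed_trm s \<Longrightarrow> beta\<^sup>*\<^sup>* (subst (cps s u) k (cps s t)) (cps s (jsubst u k t))"
proof (induction s t G K and s t arbitrary: u k and u k rule: colon_cps.induct)
  case (1 s x G K)
  then show ?case
    by (auto intro: cps_App_App_beta tranclp_into_rtranclp)
next
  case (2 s t G K)
  then show ?case
    by (auto simp: subst_semi lift_colon_cps
        intro!: beta_star_semi1 beta_star_App2 beta_star_Lam)
next
  case (3 s t u' v G K)
  note closed = \<open>closed_trm s\<close>
  let ?w = "cps s u"
  let ?G = "subst ?w k G" and ?K = "subst ?w k K"
  \<comment> \<open>Lifting commutes with \<open>cps\<close>, so below a binder the substituted term
    is again a \<open>cps\<close> image and the induction hypotheses apply.\<close>
  have w: "lift 0 ?w = cps s (jlift 0 u)" "lift 0 (lift 0 ?w) = cps s (jlift 0 (jlift 0 u))"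
    by (simp_all only: lift_colon_cps(2)[OF closed])
  have u': "beta\<^sup>*\<^sup>* (subst (lift 0 ?w) (Suc k) (cps s (jlift 0 u'))) (cps s (jlift 0 (jsubst u k u')))"
    using "3.IH"(2)[OF closed, of "jlift 0 u" "Suc k"] by (simp only: w jsubst_jlift_le)
  have "jsubst (jlift 0 (jlift 0 u)) (Suc (Suc k)) (jlift 1 v) = jlift 1 (jsubst (jlift 0 u) (Suc k) v)"
    using jsubst_jlift_le[of 1 "Suc k" "jlift 0 u" v] by (simp add: jlift_jlift)
  moreover have "subst (lift 0 (lift 0 ?w)) (Suc (Suc k)) (lift 0 (lift 0 H)) = lift 0 (lift 0 (subst ?w k H))"
    for H by (simp only: subst_lift_le)
  ultimately have v: "beta\<^sup>*\<^sup>* (subst (lift 0 (lift 0 ?w)) (Suc (Suc k))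
        (colon s (jlift 1 v) (lift 0 (lift 0 G)) (lift 0 (lift 0 K))))
      (colon s (jlift 1 (jsubst (jlift 0 u) (Suc k) v)) (lift 0 (lift 0 ?G)) (lift 0 (lift 0 ?K)))"
    using "3.IH"(1)[OF closed, of "jlift 0 (jlift 0 u)" "Suc (Suc k)"]
    by (simp only: w[symmetric])
  let ?k = "Lam (App (Lam (colon s (jlift 1 v) (lift 0 (lift 0 G)) (lift 0 (lift 0 K))))
    (App (Var 0) (cps s (jlift 0 u'))))"
  have "beta\<^sup>*\<^sup>* (subst ?w k (colon s (JApp t u' v) G K))
      (colon s (jsubst u k t) (App s ?G) (subst ?w k ?k))"
    using "3.IH"(3)[OF closed, of u k] by (simp add: closed_subst[OF closed])
  moreover have "beta\<^sup>*\<^sup>* (colon s (jsubst u k t) (App s ?G) (subst ?w k ?k))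
      (colon s (jsubst u k (JApp t u' v)) ?G ?K)"
    unfolding jsubst.simps colon.simps subst.simps
    by (rule colon_star_cong_K[OF closed], rule beta_star_Lam,
        rule rtranclp_trans[OF beta_star_App1[OF beta_star_Lam[OF v]]])
      (use u' in \<open>auto intro!: beta_star_App2\<close>)
  ultimately show ?case by (rule rtranclp_trans)
next
  case (4 s t)
  note closed = \<open>closed_trm s\<close>
  have "jsubst (jlift 0 (jlift 0 u)) (Suc (Suc k)) (jlift 0 (jlift 0 t)) =
      jlift 0 (jlift 0 (jsubst u k t))"
    by (simp only: jsubst_jlift_le)
  with "4.IH"[OF closed, of "jlift 0 (jlift 0 u)" "Suc (Suc k)"] show ?case
    by (simp add: lift_colon_cps(2)[OF closed, symmetric] cps.simps[of s t]
        cps.simps[of s "jsubst u k t"])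
      (auto intro!: beta_star_Lam)
qed

text \<open>Four contractions (\<open>semi\<close>, \<open>m\<close>, the source redex,
  \<open>x\<close>) are interleaved with two uses of \<open>subst_colon_cps\<close>.\<close>

lemma beta_simulation:
  assumes closed: "closed_trm s"
  shows "colon s (JApp (JLam t) u v) G K \<rightarrow>\<^sub>\<beta>\<^sup>+ colon s (jsubst (jsubst u 0 t) 0 v) G K"
proof -
  let ?v = "colon s v (lift 0 G) (lift 0 K)"
  have "colon s (JApp (JLam t) u v) G K \<rightarrow>\<^sub>\<beta>\<^sup>+ App (kont s u v G K) (Lam (cps s t))"
    unfolding colon_JApp[OF closed] colon.simps(2) by (intro tranclp.r_into_trancl semi_beta)
  also have "\<dots> \<rightarrow>\<^sub>\<beta> App (Lam ?v) (App (Lam (cps s t)) (cps s u))"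
    unfolding kont_def
    using b_beta[of "App (Lam (lift 1 ?v)) (App (Var 0) (lift 0 (cps s u)))" "Lam (cps s t)"]
    by simp
  \<comment> \<open>The argument is contracted before the outer redex, since
    \<open>subst_colon_cps\<close> needs the substituted term in the form
    \<open>cps s _\<close>.\<close>
  also have "\<dots> \<rightarrow>\<^sub>\<beta> App (Lam ?v) (subst (cps s u) 0 (cps s t))"
    by (intro b_app2 b_beta)
  also have "beta\<^sup>*\<^sup>* \<dots> (App (Lam ?v) (cps s (jsubst u 0 t)))"
    by (intro beta_star_App2 subst_colon_cps closed)
  also have "\<dots> \<rightarrow>\<^sub>\<beta> subst (cps s (jsubst u 0 t)) 0 ?v"
    by (rule b_beta)
  also have "beta\<^sup>*\<^sup>* \<dots> (colon s (jsubst (jsubst u 0 t) 0 v) G K)"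
    using subst_colon_cps(1)[OF closed, of "jsubst u 0 t" 0 v "lift 0 G" "lift 0 K"]
    by simp
  finally show ?thesis .
qed

lemma pi_simulation:
  assumes closed: "closed_trm s" and s_red: "\<And>G. App s G \<rightarrow>\<^sub>\<beta>\<^sup>+ G"
  shows "colon s (t \<cdot> R \<cdot> S) G K \<rightarrow>\<^sub>\<beta>\<^sup>+ colon s (t \<cdot> gappend R S) G K"
proof -
  have colon_japp: "colon s (t \<cdot> R) G K = colon s t (App s G) (kont s (fst R) (snd R) G K)"
    for t R G K by (simp only: japp_def colon_JApp[OF closed])
  \<comment> \<open>Unfolding \<open>colon\<close> at \<open>v\<close> applied to the lifted
    \<open>S\<close> yields exactly the argument \<open>App s G\<close> and the continuation of
    \<open>S\<close>, so nested continuations match without any reduction.\<close>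
  have kont_kont: "kont s u v (App s G) (kont s (fst S) (snd S) G K) = kont s u (v \<cdot> glift 0 S) G K"
    for u v S G K
  proof -
    have "lift 0 (kont s (fst S) (snd S) G K) =
        kont s (fst (glift 0 S)) (snd (glift 0 S)) (lift 0 G) (lift 0 K)"
      by (simp add: kont_def glift_def lift_colon_cps[OF closed] lift_lift jlift_jlift)
    then show ?thesis
      by (simp only: kont_def[of s u] colon_japp lift.simps closed_lift[OF closed])
  qed
  \<comment> \<open>The redex passes through two applications and the contractum through one at the
    head \<open>t\<close>: the surplus \<open>s\<close> is removed here, which is the whole
    simulation when the body of \<open>R\<close> is a value.\<close>
  have outer: "colon s t (App s (App s G)) K \<rightarrow>\<^sub>\<beta>\<^sup>+ colon s t (App s G) K" for t G K
    by (intro colon_cong_G closed beta_plus_App2 s_red)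
  show ?thesis
  proof (induction R S arbitrary: t G K rule: gappend.induct)
    case (3 u t1 u' v' S)
    \<comment> \<open>If the body of \<open>R\<close> is an application, \<open>kont_kont\<close>
      exposes a \<open>\<pi>\<close>-redex inside the continuation, to which the induction
      hypothesis applies.\<close>
    have "kont s u (t1 \<cdot> (u', v') \<cdot> glift 0 S) G K \<rightarrow>\<^sub>\<beta>\<^sup>+
        kont s u (t1 \<cdot> gappend (u', v') (glift 0 S)) G K"
      by (intro beta_plus_kont 3)
    then have "kont s u (JApp t1 u' v') (App s G) (kont s (fst S) (snd S) G K) \<rightarrow>\<^sub>\<beta>\<^sup>+
        kont s u (t1 \<cdot> gappend (u', v') (glift 0 S)) G K"
      by (simp only: kont_kont) (simp only: japp_def fst_conv snd_conv)
    then show ?case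
      unfolding colon_japp gappend.simps fst_conv snd_conv
      by (rule tranclp_trans[OF outer colon_cong_K[OF closed]])
  qed (simp_all only: colon_japp gappend.simps fst_conv snd_conv kont_kont outer)
qed

inductive_cases jred_JVarE: "JVar i \<rightarrow>\<^sub>J t"
inductive_cases jred_JLamE: "JLam t \<rightarrow>\<^sub>J t'"

text \<open>Root steps are the two preceding simulations. A step in \<open>t\<close> is passed on by
  induction, while one in \<open>u\<close> or \<open>v\<close> takes place in the continuation and
  is carried out by \<open>colon_cong_K\<close>.\<close>

lemma jred_simulation:
  assumes s_red: "\<And>G. App s G \<rightarrow>\<^sub>\<beta>\<^sup>+ G"
  shows "closed_trm s \<Longrightarrow> t \<rightarrow>\<^sub>J t' \<Longrightarrow> colon s t G K \<rightarrow>\<^sub>\<beta>\<^sup>+ colon s t' G K"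
    and "closed_trm s \<Longrightarrow> t \<rightarrow>\<^sub>J t' \<Longrightarrow> cps s t \<rightarrow>\<^sub>\<beta>\<^sup>+ cps s t'"
  using s_red
proof (induction s t G K and s t arbitrary: t' and t' rule: colon_cps.induct)
  case (3 s t u v G K)
  note closed = \<open>closed_trm s\<close>
  from \<open>JApp t u v \<rightarrow>\<^sub>J t'\<close> show ?case
  proof cases
    case (jr_beta t0)
    then show ?thesis using beta_simulation[OF closed] by blast
  next
    case (jr_pi t0 R S)
    have "JApp t u v = t0 \<cdot> R \<cdot> S" using jr_pi by (simp add: japp_def)
    then show ?thesis using jr_pi pi_simulation[OF closed "3.prems"(3)] by metis
  next
    case (jr_app1 t1)
    then show ?thesis using "3.IH"(3)[OF closed] "3.prems"(3) by simp
  next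
    case (jr_app2 u1)
    then have "cps s (jlift 0 u) \<rightarrow>\<^sub>\<beta>\<^sup>+ cps s (jlift 0 u1)"
      using "3.IH"(2)[OF closed] "3.prems"(3) jred_jlift by blast
    then show ?thesis using jr_app2
      by (auto intro!: colon_cong_K[OF closed] beta_plus_Lam beta_plus_App2)
  next
    case (jr_app3 v1)
    have "colon s (jlift 1 v) (lift 0 (lift 0 G)) (lift 0 (lift 0 K)) \<rightarrow>\<^sub>\<beta>\<^sup>+
        colon s (jlift 1 v1) (lift 0 (lift 0 G)) (lift 0 (lift 0 K))"
      using "3.IH"(1)[OF closed jred_jlift] jr_app3 "3.prems"(3) by blast
    then show ?thesis using jr_app3
      by (auto intro!: colon_cong_K[OF closed] beta_plus_Lam beta_plus_App1)
  qed
next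
  case (4 s t)
  then show ?case by (auto simp: cps.simps intro!: beta_plus_Lam jred_jlift)
\<comment> \<open>\<open>japp_def\<close> reveals the \<open>\<pi>\<close>-redex as a
  \<open>JApp\<close>, which excludes it for variables and abstractions.\<close>
qed (auto simp: japp_def elim!: jred_JVarE jred_JLamE
    intro!: beta_plus_semi1 beta_plus_App2 beta_plus_Lam)


section \<open>Typing\<close>

lemma typing_lift:
  "\<Delta>1 @ \<Delta>2 \<turnstile> t : A \<Longrightarrow> \<Delta>1 @ B # \<Delta>2 \<turnstile> lift (length \<Delta>1) t : A"
proof (induction "\<Delta>1 @ \<Delta>2" t A arbitrary: \<Delta>1 rule: typing.induct)
  case (t_lam A t C)
  then show ?case using t_lam.hyps(2)[of "A # \<Delta>1"] by (auto intro: typing.intros)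
qed (auto intro: typing.intros simp: nth_append)

lemma typing_lift0: "\<Delta> \<turnstile> t : A \<Longrightarrow> B # \<Delta> \<turnstile> lift 0 t : A"
  using typing_lift[of "[]"] by simp

text \<open>Extending a context on the right changes no index, so the unlifted \<open>s\<close>,
  typed in the empty context, is typable in every context.\<close>

lemma typing_append: "\<Delta> \<turnstile> t : A \<Longrightarrow> \<Delta> @ \<Delta>' \<turnstile> t : A"
  by (induction rule: typing.induct) (auto intro: typing.intros simp: nth_append)

text \<open>Below the binders \<open>g\<close> and \<open>k\<close>, the context is no longer of the form \<open>map (ty_bar b T) \<Gamma>\<close>;
  hence source terms are typed directly in target contexts.\<close>

inductive cps_typing :: "nat \<Rightarrow> ty \<Rightarrow> ty list \<Rightarrow> jtrm \<Rightarrow> ty \<Rightarrow> bool" for b T where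
  ct_var: "i < length \<Delta> \<Longrightarrow> \<Delta> ! i = ty_bar b T A \<Longrightarrow> cps_typing b T \<Delta> (JVar i) A"
| ct_lam: "cps_typing b T (ty_bar b T A # \<Delta>) t B \<Longrightarrow> cps_typing b T \<Delta> (JLam t) (Fun A B)"
| ct_app: "cps_typing b T \<Delta> t (Fun A B) \<Longrightarrow> cps_typing b T \<Delta> u A \<Longrightarrow>
    cps_typing b T (ty_bar b T B # \<Delta>) v C \<Longrightarrow> cps_typing b T \<Delta> (JApp t u v) C"

inductive_cases cps_typing_JVarE: "cps_typing b T \<Delta> (JVar i) A"
inductive_cases cps_typing_JLamE: "cps_typing b T \<Delta> (JLam t) A"
inductive_cases cps_typing_JAppE: "cps_typing b T \<Delta> (JApp t u v) A"

lemma jtyping_cps_typing: "\<Gamma> \<turnstile>\<^sub>J t : A \<Longrightarrow> cps_typing b T (map (ty_bar b T) \<Gamma>) t A"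
  by (induction rule: jtyping.induct) (auto intro: cps_typing.intros)

text \<open>The inserted \<open>B\<close> is an arbitrary target type, as the declarations of
  \<open>g\<close>, \<open>k\<close> and \<open>m\<close> require.\<close>

lemma cps_typing_jlift:
  "cps_typing b T (\<Delta>1 @ \<Delta>2) t A \<Longrightarrow> cps_typing b T (\<Delta>1 @ B # \<Delta>2) (jlift (length \<Delta>1) t) A"
proof (induction "\<Delta>1 @ \<Delta>2" t A arbitrary: \<Delta>1 rule: cps_typing.induct)
  case (ct_lam A t C)
  then show ?case
    using ct_lam.hyps(2)[of "ty_bar b T A # \<Delta>1"]
    by (auto intro: cps_typing.intros)
next
  case (ct_app t A C u v D)
  then show ?case
    using ct_app.hyps(6)[of "ty_bar b T C # \<Delta>1"]
    by (auto intro: cps_typing.intros)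
qed (auto intro: cps_typing.intros simp: nth_append)

lemma cps_typing_jlift0: "cps_typing b T \<Delta> t A \<Longrightarrow> cps_typing b T (B # \<Delta>) (jlift 0 t) A"
  using cps_typing_jlift[of b T "[]"] by simp

lemma cps_typing_jlift1:
  "cps_typing b T (C # \<Delta>) t A \<Longrightarrow> cps_typing b T (C # B # \<Delta>) (jlift 1 t) A"
  using cps_typing_jlift[of b T "[C]"] by simp

lemma typing_semi: "\<Delta> \<turnstile> t : A \<Longrightarrow> \<Delta> \<turnstile> u : B \<Longrightarrow> \<Delta> \<turnstile> semi t u : A"
  unfolding semi_def by (blast intro: typing.intros typing_lift0)

text \<open>\<open>G\<close> inhabits \<open>T\<close>, \<open>K\<close> is a continuation for
  values of type \<open>ty_star b T A\<close>, and the answer type is the fixed variable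
  \<open>b\<close>.\<close>

lemma typing_colon_cps:
  shows "[] \<turnstile> s : Fun T T \<Longrightarrow> cps_typing b T \<Delta> t A \<Longrightarrow> \<Delta> \<turnstile> G : T \<Longrightarrow>
      \<Delta> \<turnstile> K : neg b (ty_star b T A) \<Longrightarrow> \<Delta> \<turnstile> colon s t G K : TVar b"
    and "[] \<turnstile> s : Fun T T \<Longrightarrow> cps_typing b T \<Delta> t A \<Longrightarrow> \<Delta> \<turnstile> cps s t : ty_bar b T A"
proof (induction s t G K and s t arbitrary: \<Delta> A and \<Delta> A rule: colon_cps.induct)
  case (1 s x G K)
  then show ?case
    by (auto elim!: cps_typing_JVarE simp: ty_bar.simps neg_def intro!: t_app intro: t_var)
next
  case (2 s t G K)
  from "2.prems"(2) obtain B C where A: "A = Fun B C"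
    and "cps_typing b T (ty_bar b T B # \<Delta>) t C"
    by (rule cps_typing_JLamE)
  then have "\<Delta> \<turnstile> Lam (cps s t) : ty_star b T A"
    using "2.IH" "2.prems"(1) by (auto intro: t_lam)
  then have "\<Delta> \<turnstile> App K (Lam (cps s t)) : TVar b"
    using "2.prems"(4) unfolding neg_def by (rule t_app[rotated])
  then show ?case
    unfolding colon.simps by (rule typing_semi[OF _ "2.prems"(3)])
next
  case (3 s t u v G K)
  from "3.prems"(2) obtain B C where t: "cps_typing b T \<Delta> t (Fun B C)"
    and u: "cps_typing b T \<Delta> u B" and v: "cps_typing b T (ty_bar b T C # \<Delta>) v A"
    by (rule cps_typing_JAppE)
  \<comment> \<open>\<open>?M\<close> is the type of \<open>m\<close>, a function between the barred
    types, and \<open>?C\<close> is the type of \<open>x\<close>.\<close>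
  let ?M = "ty_star b T (Fun B C)" and ?C = "ty_bar b T C"
  have "?C # ?M # \<Delta> \<turnstile>
      colon s (jlift 1 v) (lift 0 (lift 0 G)) (lift 0 (lift 0 K)) : TVar b"
    by (rule "3.IH"(1)[OF "3.prems"(1) cps_typing_jlift1[OF v]])
      (intro typing_lift0 "3.prems")+
  moreover have "?M # \<Delta> \<turnstile> App (Var 0) (cps s (jlift 0 u)) : ?C"
    by (rule t_app[OF t_var "3.IH"(2)[OF "3.prems"(1) cps_typing_jlift0[OF u]]]) simp_all
  ultimately have "\<Delta> \<turnstile> Lam (App (Lam (colon s (jlift 1 v) (lift 0 (lift 0 G)) (lift 0 (lift 0 K))))
      (App (Var 0) (cps s (jlift 0 u)))) : neg b ?M"
    unfolding neg_def by (rule t_lam[OF t_app[OF t_lam]])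
  moreover have "\<Delta> \<turnstile> App s G : T"
    using typing_append[OF "3.prems"(1), of \<Delta>] "3.prems"(3) by (auto intro: t_app)
  ultimately show ?case
    unfolding colon.simps using "3.IH"(3)[OF "3.prems"(1) t] by blast
next
  case (4 s t)
  have "neg b (ty_star b T A) # T # \<Delta> \<turnstile> colon s (jlift 0 (jlift 0 t)) (Var 1) (Var 0) : TVar b"
    by (rule "4.IH"[OF "4.prems"(1) cps_typing_jlift0[OF cps_typing_jlift0[OF "4.prems"(2)]]
          t_var t_var]) simp_all
  then show ?case
    by (simp add: cps.simps ty_bar.simps neg_def[of b "neg b _"] t_lam)
qed

theorem theorem4p10:
  fixes b :: nat and T :: ty and s :: trm
  assumes s_closed: "closed_trm s"
    and s_type: "[] \<turnstile> s : T \<supset> T"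
    and s_red: "\<And>G. App s G \<rightarrow>\<^sub>\<beta>\<^sup>+ G"
  shows "(\<forall>\<Gamma> t A. (\<Gamma> \<turnstile>\<^sub>J t : A) \<longrightarrow> (map (ty_bar b T) \<Gamma> \<turnstile> cps s t : ty_bar b T A)) \<and>
         (\<forall>t u. t \<rightarrow>\<^sub>J u \<longrightarrow> cps s t \<rightarrow>\<^sub>\<beta>\<^sup>+ cps s u)"
proof (intro conjI allI impI)
  show "map (ty_bar b T) \<Gamma> \<turnstile> cps s t : ty_bar b T A" if "\<Gamma> \<turnstile>\<^sub>J t : A" for \<Gamma> t A
    by (rule typing_colon_cps(2)[OF s_type jtyping_cps_typing[OF that]])
  show "cps s t \<rightarrow>\<^sub>\<beta>\<^sup>+ cps s u" if "t \<rightarrow>\<^sub>J u" for t u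
    by (rule jred_simulation(2)[OF s_red s_closed that])
qed

end
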